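(* Let $\mathcal{N}$ be the network with source $S$, intermediate vertices $V_1,\dots,V_6$, five terminals $T_1,\dots,T_5$, and exactly the following edges (one each): $S\to V_1$, $S\to V_2$; $V_1\to V_3$, $V_2\to V_3$; $V_1\to V_4$, $V_2\to V_4$; $V_3\to V_5$; $V_4\to V_6$; $V_1\to T_1$, $V_5\to T_1$; $V_1\to T_2$, $V_6\to T_2$; $V_5\to T_3$, $V_6\to T_3$; $V_2\to T_4$, $V_5\to T_4$; $V_2\to T_5$, $V_6\to T_5$. Let $q$ be a prime power and $\mathcal{A}=\mathbb{F}_q$. Then $$\mathrm{C}_1^{\mathrm{lin}}(\mathcal{N},\mathcal{A})=\begin{cases}1 & \text{if } q=2,\\ 2 & \text{otherwise.}\end{cases}$$
   Context: A (single-source) network is a tuple $\mathcal{N}=(\mathcal{V},\mathcal{E},S,\mathbf{T})$ where $(\mathcal{V},\mathcal{E})$ is a finite directed acyclic multigraph, $S\in\mathcal{V}$ is the source, $\mathbf{T}\subseteq\mathcal{V}\setminus\{S\}$ is a nonempty set of terminals, the source has no incoming edges, terminals have no outgoing edges, there is a directed path from $S$ to every terminal, and every other (intermediate) vertex lies on a directed path from $S$ to it and has a directed path to some terminal. $\mathrm{in}(V)$ and $\mathrm{out}(V)$ denote the sets of incoming and outgoing edges of $V$. An alphabet $\mathcal{A}$ is a finite set with at least 2 elements; each edge carries exactly one symbol of $\mathcal{A}$. The edges are totally ordered by some fixed total order extending the partial order "$e\preccurlyeq e'$ if there is a directed path starting with $e$ and ending with $e'$" (the choice of extension does not matter), and this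 is used to index coordinates. A network code for $(\mathcal{N},\mathcal{A})$ is a family $\mathcal{F}=\{\mathcal{F}_V\}$, indexed by the intermediate vertices, of functions $\mathcal{F}_V:\mathcal{A}^{|\mathrm{in}(V)|}\to\mathcal{A}^{|\mathrm{out}(V)|}$. For a terminal $T$, $\Omega[\mathcal{N},\mathcal{F},S\to T]:\mathcal{A}^{|\mathrm{out}(S)|}\to\mathcal{A}^{|\mathrm{in}(T)|}$ is the function that sends the vector of symbols emitted by $S$ on its outgoing edges to the vector of symbols arriving on the incoming edges of $T$ when every intermediate vertex $V$ applies $\mathcal{F}_V$ to its incoming symbols. An outer code is a nonempty subset $\mathcal{C}\subseteq\mathcal{A}^{|\mathrm{out}(S)|}$. The pair $(\mathcal{C},\mathcal{F})$ is unambiguous for $(\mathcal{N},\mathcal{A})$ if for every $T\in\mathbf{T}$ the function $\Omega[\mathcal{N},\mathcal{F},S\to T]$ is injective on $\mathcal{C}$. For $\mathcal{A}=\mathbb{F}_q$, the (1-shot) linear capacity is $\mathrm{C}_1^{\mathrm{lin}}(\mathcal{N},\mathcal{A})=\max\{\log_{q}|\mathcal{C}| : (\mathcal{C},\mathcal{F})\text{ is unambiguous for }(\mathcal{N},\mathcal{A})\text{ for some network code }\mathcal{F}\text{ all of whose functions }\mathcal{F}_V\text{ are }\mathbb{F}_q\text{-linear}\}$. The outer code $\mathcal{C}$ is not required to be linear. *)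

theory Defs
  imports
    Complex_Main
    "HOL-Library.FuncSet"
    "HOL-Library.Cardinality"
    "HOL-Number_Theory.Prime_Powers"
    "Graph_Theory.Digraph"
begin

record ('v, 'e) net =
  graph :: "('v, 'e) pre_digraph"
  source :: 'v
  terminals :: "'v set"

definition intermediates :: "('v, 'e) net \<Rightarrow> 'v set" where
  "intermediates N = verts (graph N) - {source N} - terminals N"

locale network =
  fixes N :: "('v, 'e) net"
  assumes fin_digraph: "fin_digraph (graph N)"
    and acyclic: "acyclic (arcs_ends (graph N))"
    and source_vert: "source N \<in> verts (graph N)"
    and terminals_subset: "terminals N \<subseteq> verts (graph N) - {source N}"
    and terminals_nonempty: "terminals N \<noteq> {}"
    and source_in: "in_arcs (graph N) (source N) = {}"
    and terminal_out: "\<And>T. T \<in> terminals N \<Longrightarrow> out_arcs (graph N) T = {}"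
    and terminal_reachable: "\<And>T. T \<in> terminals N \<Longrightarrow> source N \<rightarrow>\<^sup>*\<^bsub>graph N\<^esub> T"
    and intermediate_reachable:
      "\<And>V. V \<in> intermediates N \<Longrightarrow> source N \<rightarrow>\<^sup>*\<^bsub>graph N\<^esub> V"
    and intermediate_to_terminal:
      "\<And>V. V \<in> intermediates N \<Longrightarrow> \<exists>T \<in> terminals N. V \<rightarrow>\<^sup>*\<^bsub>graph N\<^esub> T"

text \<open>
  The alphabet is the whole type \<open>'a\<close>. A vector with one coordinate per element
  of a finite edge set \<open>X\<close> is represented as an extensional function in
  \<open>X \<rightarrow>\<^sub>E UNIV\<close>, so coordinates are indexed by the edges themselves and no linear
  order on the edges is needed to enumerate them.
\<close>

type_synonym ('v, 'e, 'a) code_family = "'v \<Rightarrow> ('e \<Rightarrow> 'a) \<Rightarrow> ('e \<Rightarrow> 'a)"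

definition network_code :: "('v, 'e) net \<Rightarrow> ('v, 'e, 'a) code_family \<Rightarrow> bool" where
  "network_code N F \<longleftrightarrow>
     (\<forall>V \<in> intermediates N.
        F V \<in> (in_arcs (graph N) V \<rightarrow>\<^sub>E UNIV) \<rightarrow> (out_arcs (graph N) V \<rightarrow>\<^sub>E UNIV))"

text \<open>
  \<open>net_flow N F x z\<close>: the edges carry the symbols \<open>z\<close> when the source emits \<open>x\<close> and
  every intermediate vertex applies its function. The symbols are determined
  by \<open>x\<close>; see lemma \<open>net_flow_unique\<close>.
\<close>

definition net_flow ::
  "('v, 'e) net \<Rightarrow> ('v, 'e, 'a) code_family \<Rightarrow> ('e \<Rightarrow> 'a) \<Rightarrow> ('e \<Rightarrow> 'a) \<Rightarrow> bool" where
  "net_flow N F x z \<longleftrightarrow>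
     z \<in> arcs (graph N) \<rightarrow>\<^sub>E UNIV \<and>
     restrict z (out_arcs (graph N) (source N)) = x \<and>
     (\<forall>V \<in> intermediates N.
        restrict z (out_arcs (graph N) V) = F V (restrict z (in_arcs (graph N) V)))"

definition transfer ::
  "('v, 'e) net \<Rightarrow> ('v, 'e, 'a) code_family \<Rightarrow> 'v \<Rightarrow> ('e \<Rightarrow> 'a) \<Rightarrow> ('e \<Rightarrow> 'a)" where
  "transfer N F T x = restrict (THE z. net_flow N F x z) (in_arcs (graph N) T)"

definition outer_code :: "('v, 'e) net \<Rightarrow> ('e \<Rightarrow> 'a) set \<Rightarrow> bool" where
  "outer_code N C \<longleftrightarrow> C \<noteq> {} \<and> C \<subseteq> (out_arcs (graph N) (source N) \<rightarrow>\<^sub>E UNIV)"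

definition unambiguous ::
  "('v, 'e) net \<Rightarrow> ('e \<Rightarrow> 'a) set \<Rightarrow> ('v, 'e, 'a) code_family \<Rightarrow> bool" where
  "unambiguous N C F \<longleftrightarrow> (\<forall>T \<in> terminals N. inj_on (transfer N F T) C)"

definition linear_on_edges ::
  "'e set \<Rightarrow> 'e set \<Rightarrow> (('e \<Rightarrow> 'a) \<Rightarrow> ('e \<Rightarrow> 'a :: field)) \<Rightarrow> bool" where
  "linear_on_edges X Y f \<longleftrightarrow>
     (\<forall>x \<in> X \<rightarrow>\<^sub>E UNIV. \<forall>y \<in> X \<rightarrow>\<^sub>E UNIV.
        f (\<lambda>e\<in>X. x e + y e) = (\<lambda>e\<in>Y. f x e + f y e)) \<and>
     (\<forall>c. \<forall>x \<in> X \<rightarrow>\<^sub>E UNIV. f (\<lambda>e\<in>X. c * x e) = (\<lambda>e\<in>Y. c * f x e))"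

definition linear_network_code ::
  "('v, 'e) net \<Rightarrow> ('v, 'e, 'a :: field) code_family \<Rightarrow> bool" where
  "linear_network_code N F \<longleftrightarrow>
     network_code N F \<and>
     (\<forall>V \<in> intermediates N.
        linear_on_edges (in_arcs (graph N) V) (out_arcs (graph N) V) (F V))"

definition linear_rates :: "'a :: {finite, field} itself \<Rightarrow> ('v, 'e) net \<Rightarrow> real set" where
  "linear_rates _ N =
     {log (real CARD('a)) (real (card C)) | (C :: ('e \<Rightarrow> 'a) set) F.
        outer_code N C \<and> linear_network_code N F \<and> unambiguous N C F}"

definition linear_capacity :: "'a :: {finite, field} itself \<Rightarrow> ('v, 'e) net \<Rightarrow> real" where
  "linear_capacity A N = Max (linear_rates A N)"

context network
begin

lemma wf_edge_pred:
  "wf {(e', e). e' \<in> arcs (graph N) \<and> e \<in> arcs (graph N) \<and> head (graph N) e' = tail (graph N) e}"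
    (is "wf ?R")
proof -
  interpret fin_digraph "graph N" by (rule fin_digraph)
  have "finite (arcs_ends (graph N))" by (simp add: arcs_ends_def)
  then have "wf (arcs_ends (graph N))" by (rule finite_acyclic_wf[OF _ acyclic])
  then have "wf (inv_image (arcs_ends (graph N)) (tail (graph N)))" by (rule wf_inv_image)
  moreover have "?R \<subseteq> inv_image (arcs_ends (graph N)) (tail (graph N))"
    by (force simp: arcs_ends_conv)
  ultimately show ?thesis by (rule wf_subset)
qed

lemma net_flow_unique:
  assumes F: "network_code N F"
    and x: "x \<in> out_arcs (graph N) (source N) \<rightarrow>\<^sub>E UNIV"
  shows "\<exists>!z. net_flow N F x z"
proof -
  let ?G = "graph N" and ?s = "source N"
  let ?R = "{(e', e). e' \<in> arcs ?G \<and> e \<in> arcs ?G \<and> head ?G e' = tail ?G e}"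
  interpret fin_digraph ?G by (rule fin_digraph)
  have tail_cases: "tail ?G e = ?s \<or> tail ?G e \<in> intermediates N" if "e \<in> arcs ?G" for e
    using that terminal_out[of "tail ?G e"] by (auto simp: intermediates_def out_arcs_def)
  define step where "step z e =
    (if tail ?G e = ?s then x e else F (tail ?G e) (restrict z (in_arcs ?G (tail ?G e))) e)"
    for z e
  have step_cong: "step z e = step z' e"
    if "e \<in> arcs ?G" and "\<And>e'. (e', e) \<in> ?R \<Longrightarrow> z e' = z' e'" for z z' e
  proof -
    have "restrict z (in_arcs ?G (tail ?G e)) = restrict z' (in_arcs ?G (tail ?G e))"
      using that by (auto simp: in_arcs_def intro!: restrict_ext)
    then show ?thesis by (simp add: step_def)
  qed
  have flow_iff: "net_flow N F x z \<longleftrightarrow>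
      z \<in> arcs ?G \<rightarrow>\<^sub>E UNIV \<and> (\<forall>e \<in> arcs ?G. z e = step z e)" (is "?L \<longleftrightarrow> ?Rhs") for z
  proof
    assume L: ?L
    have "z e = step z e" if e: "e \<in> arcs ?G" for e
    proof (cases "tail ?G e = ?s")
      case True
      then have "restrict z (out_arcs ?G ?s) e = z e" using e by (simp add: out_arcs_def)
      moreover have "restrict z (out_arcs ?G ?s) = x" using L by (simp add: net_flow_def)
      ultimately show ?thesis using True by (simp add: step_def)
    next
      case False
      then have V: "tail ?G e \<in> intermediates N" using tail_cases[OF e] by simp
      have "z e = restrict z (out_arcs ?G (tail ?G e)) e" using e by (simp add: out_arcs_def)
      also have "\<dots> = F (tail ?G e) (restrict z (in_arcs ?G (tail ?G e))) e"
        using L V by (simp add: net_flow_def)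
      finally show ?thesis using False by (simp add: step_def)
    qed
    then show ?Rhs using L by (simp add: net_flow_def)
  next
    assume R: ?Rhs
    have "restrict z (out_arcs ?G ?s) = x"
      using R x by (auto simp: fun_eq_iff restrict_def step_def out_arcs_def PiE_def extensional_def)
    moreover have "restrict z (out_arcs ?G V) = F V (restrict z (in_arcs ?G V))"
      if V: "V \<in> intermediates N" for V
    proof
      fix e
      have "F V (restrict z (in_arcs ?G V)) \<in> out_arcs ?G V \<rightarrow>\<^sub>E UNIV"
        using F V by (auto simp: network_code_def Pi_def)
      moreover have "V \<noteq> ?s" using V by (simp add: intermediates_def)
      ultimately show "restrict z (out_arcs ?G V) e = F V (restrict z (in_arcs ?G V)) e"
        using R by (auto simp: restrict_def step_def out_arcs_def PiE_def extensional_def)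
    qed
    ultimately show ?L using R by (simp add: net_flow_def)
  qed
  show ?thesis
  proof (rule ex_ex1I)
    define w where "w = wfrec ?R step"
    have "w e = step (cut w ?R e) e" for e
      unfolding w_def by (rule wfrec[OF wf_edge_pred])
    then have w: "w e = step w e" if "e \<in> arcs ?G" for e
      using that step_cong[of e "cut w ?R e" w] by (simp add: cut_apply)
    have "net_flow N F x (restrict w (arcs ?G))"
      unfolding flow_iff
    proof (intro conjI ballI)
      fix e assume e: "e \<in> arcs ?G"
      have "step w e = step (restrict w (arcs ?G)) e"
        by (rule step_cong[OF e]) auto
      then show "restrict w (arcs ?G) e = step (restrict w (arcs ?G)) e"
        using e w by simp
    qed simp
    then show "\<exists>z. net_flow N F x z" by blast
  next
    fix z z' assume zz': "net_flow N F x z" "net_flow N F x z'"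
    have "e \<in> arcs ?G \<longrightarrow> z e = z' e" for e
    proof (induction e rule: wf_induct_rule[OF wf_edge_pred])
      case (1 e)
      show ?case
      proof
        assume e: "e \<in> arcs ?G"
        have "step z e = step z' e" by (rule step_cong[OF e]) (use 1 in auto)
        then show "z e = z' e" using e zz' by (simp add: flow_iff)
      qed
    qed
    then show "z = z'"
      using zz' by (auto simp: flow_iff intro: PiE_ext)
  qed
qed

lemma finite_linear_rates: "finite (linear_rates TYPE('a :: {finite, field}) N)"
proof -
  interpret fin_digraph "graph N" by (rule fin_digraph)
  let ?D = "out_arcs (graph N) (source N) \<rightarrow>\<^sub>E (UNIV :: 'a set)"
  have "finite ?D" by (intro finite_PiE) auto
  then have "finite ((\<lambda>C. log (real CARD('a)) (real (card C))) ` Pow ?D)" by simp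
  then show ?thesis
    by (rule finite_subset[rotated]) (auto simp: linear_rates_def outer_code_def)
qed

lemma linear_rates_nonempty: "linear_rates TYPE('a :: {finite, field}) N \<noteq> {}"
proof -
  let ?C = "{\<lambda>e \<in> out_arcs (graph N) (source N). 0 :: 'a}"
  let ?F = "\<lambda>V (x :: 'b \<Rightarrow> 'a). \<lambda>e \<in> out_arcs (graph N) V. 0 :: 'a"
  have "outer_code N ?C" "linear_network_code N ?F" "unambiguous N ?C ?F"
    by (auto simp: outer_code_def linear_network_code_def network_code_def
        linear_on_edges_def unambiguous_def fun_eq_iff)
  then show ?thesis unfolding linear_rates_def by blast
qed

end

datatype fig_vertex = Src | V1 | V2 | V3 | V4 | V5 | V6 | T1 | T2 | T3 | T4 | T5

definition fig_edges :: "(fig_vertex \<times> fig_vertex) set" where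
  "fig_edges =
     {(Src, V1), (Src, V2),
      (V1, V3), (V2, V3),
      (V1, V4), (V2, V4),
      (V3, V5),
      (V4, V6),
      (V1, T1), (V5, T1),
      (V1, T2), (V6, T2),
      (V5, T3), (V6, T3),
      (V2, T4), (V5, T4),
      (V2, T5), (V6, T5)}"

definition fig_network :: "(fig_vertex, fig_vertex \<times> fig_vertex) net" where
  "fig_network =
     \<lparr> graph = \<lparr> verts = UNIV, arcs = fig_edges, tail = fst, head = snd \<rparr>,
       source = Src,
       terminals = {T1, T2, T3, T4, T5} \<rparr>"

lemma UNIV_fig_vertex: "(UNIV :: fig_vertex set) = {Src, V1, V2, V3, V4, V5, V6, T1, T2, T3, T4, T5}"
  using fig_vertex.exhaust by blast

lemma network_fig_network: "network fig_network"
proof -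
  let ?G = "graph fig_network"
  define rank :: "fig_vertex \<Rightarrow> nat" where
    "rank v = (case v of Src \<Rightarrow> 0 | V1 \<Rightarrow> 1 | V2 \<Rightarrow> 1 | V3 \<Rightarrow> 2 | V4 \<Rightarrow> 2 | V5 \<Rightarrow> 3 | V6 \<Rightarrow> 3 | _ \<Rightarrow> 4)" for v
  have fin: "fin_digraph ?G"
    by unfold_locales (auto simp: fig_network_def UNIV_fig_vertex fig_edges_def)
  then interpret fin_digraph ?G .
  have ends: "arcs_ends ?G = fig_edges"
    by (auto simp: fig_network_def arcs_ends_conv)
  have "fig_edges \<subseteq> measure rank" by (auto simp: fig_edges_def rank_def)
  then have "wf fig_edges" using wf_measure wf_subset by blast
  then have acyc: "acyclic (arcs_ends ?G)" unfolding ends by (rule wf_acyclic)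
  have vert: "v \<in> verts ?G" for v by (simp add: fig_network_def)
  have adj: "u \<rightarrow>\<^sup>*\<^bsub>?G\<^esub> v" if "(u, v) \<in> fig_edges" for u v
    using that ends by (intro reachable_adjI) simp
  have e: "Src \<rightarrow>\<^sup>*\<^bsub>?G\<^esub> V1" "Src \<rightarrow>\<^sup>*\<^bsub>?G\<^esub> V2" "V1 \<rightarrow>\<^sup>*\<^bsub>?G\<^esub> V3" "V1 \<rightarrow>\<^sup>*\<^bsub>?G\<^esub> V4"
    "V3 \<rightarrow>\<^sup>*\<^bsub>?G\<^esub> V5" "V4 \<rightarrow>\<^sup>*\<^bsub>?G\<^esub> V6" "V1 \<rightarrow>\<^sup>*\<^bsub>?G\<^esub> T1" "V1 \<rightarrow>\<^sup>*\<^bsub>?G\<^esub> T2" "V5 \<rightarrow>\<^sup>*\<^bsub>?G\<^esub> T3"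
    "V6 \<rightarrow>\<^sup>*\<^bsub>?G\<^esub> T3" "V2 \<rightarrow>\<^sup>*\<^bsub>?G\<^esub> T4" "V2 \<rightarrow>\<^sup>*\<^bsub>?G\<^esub> T5"
    by (auto intro!: adj simp: fig_edges_def)
  have from_Src: "Src \<rightarrow>\<^sup>*\<^bsub>?G\<^esub> v" for v
    by (cases v) (use e vert in \<open>blast intro: reachable_trans reachable_refl\<close>)+
  have to_T: "\<exists>T \<in> {T1, T2, T3, T4, T5}. v \<rightarrow>\<^sup>*\<^bsub>?G\<^esub> T" for v
    by (cases v) (use e vert in \<open>blast intro: reachable_trans reachable_refl\<close>)+
  show ?thesis
  proof
    show "source fig_network \<rightarrow>\<^sup>*\<^bsub>?G\<^esub> v" for v
      using from_Src by (simp add: fig_network_def)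
    then show "source fig_network \<rightarrow>\<^sup>*\<^bsub>?G\<^esub> v" for v .
    show "\<exists>T \<in> terminals fig_network. v \<rightarrow>\<^sup>*\<^bsub>?G\<^esub> T" for v
      using to_T by (simp add: fig_network_def)
  qed (use fin acyc in \<open>auto simp: fig_network_def fig_edges_def in_arcs_def out_arcs_def\<close>)
qed

end

(* Over the flow of a linear code, the edges (V3,V5) and (V4,V6) carry linear forms
   p = a x1 + b x2 and r = c x1 + d x2 of the two source symbols, and the terminals must
   separate codewords by (x1,p), (x1,r), (p,r), (x2,p), (x2,r). For q > 2 the forms
   x1 + x2 and x1 + c x2 with c not in {0,1} make all five pairs of forms independent.
   For q = 2, if |C| > 2 then no single binary function is injective on C; hence p and r
   must both involve x1 and x2, so p = r = x1 + x2 and T3 sees a single bit. *)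

theory Submission
  imports Defs
begin

section \<open>Linear network codes by coefficients\<close>

text \<open>Expand \<open>x\<close> in unit vectors and use additivity and homogeneity of
  \<open>f\<close>. The coefficients form the row of the matrix of \<open>f\<close> that belongs to
  the edge \<open>e\<close>.\<close>

lemma linear_on_edges_coefficients:
  fixes f :: "('e \<Rightarrow> 'a :: field) \<Rightarrow> ('e \<Rightarrow> 'a)"
  assumes lin: "linear_on_edges X Y f" and fin: "finite X" and e: "e \<in> Y"
    and x: "x \<in> X \<rightarrow>\<^sub>E UNIV"
  shows "f x e = (\<Sum>e'\<in>X. f (\<lambda>i\<in>X. if i = e' then 1 else 0) e * x e')"
proof -
  let ?u = "\<lambda>e'. \<lambda>i\<in>X. if i = e' then 1 else 0 :: 'a"
  have add: "f (\<lambda>i\<in>X. u i + v i) e = f u e + f v e"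
    if "u \<in> X \<rightarrow>\<^sub>E UNIV" "v \<in> X \<rightarrow>\<^sub>E UNIV" for u v
    using lin e that by (simp add: linear_on_edges_def)
  have scale: "f (\<lambda>i\<in>X. c * u i) e = c * f u e" if "u \<in> X \<rightarrow>\<^sub>E UNIV" for c u
    using lin e that by (simp add: linear_on_edges_def)
  \<comment> \<open>Coordinates outside \<open>S\<close> are switched off, so induction on
    \<open>S\<close> brings them in one at a time; \<open>S = X\<close> gives back
    \<open>x\<close>.\<close>
  have "f (\<lambda>i\<in>X. if i \<in> S then x i else 0) e = (\<Sum>e'\<in>S. f (?u e') e * x e')"
    if "finite S" "S \<subseteq> X" for S
    using that
  proof (induction S rule: finite_induct)
    case empty
    have "f (\<lambda>i\<in>X. 0 * x i) e = 0" using scale[OF x, of 0] by simp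
    then show ?case by (simp add: restrict_def)
  next
    case (insert s S)
    let ?v = "\<lambda>i\<in>X. if i \<in> S then x i else 0" and ?w = "\<lambda>i\<in>X. x s * ?u s i"
    have "(\<lambda>i\<in>X. if i \<in> insert s S then x i else 0) = (\<lambda>i\<in>X. ?v i + ?w i)"
      using insert.hyps by (auto simp: fun_eq_iff)
    then have "f (\<lambda>i\<in>X. if i \<in> insert s S then x i else 0) e = f ?v e + f ?w e"
      using add[of ?v ?w] by simp
    also have "f ?w e = x s * f (?u s) e" by (rule scale[of "?u s" "x s"]) auto
    finally show ?case using insert by (simp add: mult.commute restrict_def)
  qed
  from this[OF fin] have "f (\<lambda>i\<in>X. if i \<in> X then x i else 0) e = (\<Sum>e'\<in>X. f (?u e') e * x e')"
    by simp
  moreover have "(\<lambda>i\<in>X. if i \<in> X then x i else 0) = x"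
    using x by (auto simp: fun_eq_iff PiE_def extensional_def)
  ultimately show ?thesis by simp
qed

text \<open>An edge has only one tail, so a single table \<open>k\<close>, indexed by an outgoing
  and an incoming edge, holds the matrices of all vertices at once.\<close>

definition coefficient_code ::
  "('v, 'e) net \<Rightarrow> ('e \<Rightarrow> 'e \<Rightarrow> 'a :: field) \<Rightarrow> ('v, 'e, 'a) code_family" where
  "coefficient_code N k V x =
     (\<lambda>e\<in>out_arcs (graph N) V. \<Sum>e'\<in>in_arcs (graph N) V. k e e' * x e')"

lemma linear_coefficient_code: "linear_network_code N (coefficient_code N k)"
  by (auto simp: linear_network_code_def network_code_def linear_on_edges_def
      coefficient_code_def fun_eq_iff sum.distrib sum_distrib_left algebra_simps)

text \<open>The flow laws with the local functions eliminated. Arbitrary linear codes, for the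
  converse, and explicit ones, for achievability, are both reduced to these equations.\<close>

definition edge_equations ::
  "('v, 'e) net \<Rightarrow> ('e \<Rightarrow> 'e \<Rightarrow> 'a :: field) \<Rightarrow> ('e \<Rightarrow> 'a) \<Rightarrow> bool" where
  "edge_equations N k z \<longleftrightarrow>
     (\<forall>V\<in>intermediates N. \<forall>e\<in>out_arcs (graph N) V.
        z e = (\<Sum>e'\<in>in_arcs (graph N) V. k e e' * z e'))"

lemma net_flow_coefficient_code:
  assumes "net_flow N (coefficient_code N k) x z"
  shows "edge_equations N k z"
  unfolding edge_equations_def
proof (intro ballI)
  fix V e assume V: "V \<in> intermediates N" and e: "e \<in> out_arcs (graph N) V"
  have "z e = restrict z (out_arcs (graph N) V) e" using e by simp
  also have "\<dots> = coefficient_code N k V (restrict z (in_arcs (graph N) V)) e"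
    using assms V by (simp add: net_flow_def)
  also have "\<dots> = (\<Sum>e'\<in>in_arcs (graph N) V. k e e' * z e')"
    using e by (simp add: coefficient_code_def del: in_in_arcs_conv)
  finally show "z e = (\<Sum>e'\<in>in_arcs (graph N) V. k e e' * z e')" .
qed

section \<open>Flows of linear codes and the capacity as a maximum\<close>

context network
begin

text \<open>One table serves all inputs, because its entries depend on \<open>F\<close> alone. This
  uniformity later allows two codewords to be compared edge by edge.\<close>

lemma linear_flow_equations:
  assumes "linear_network_code N (F :: ('v, 'e, 'c :: field) code_family)"
  obtains k where "\<And>x z. net_flow N F x z \<Longrightarrow> edge_equations N k z"
proof
  let ?G = "graph N"
  interpret fin_digraph ?G by (rule fin_digraph)
  \<comment> \<open>The entry is the response on \<open>e\<close> to the unit vector at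
    \<open>e'\<close>; the vertex is recovered as the tail of \<open>e\<close>.\<close>
  define k where "k = (\<lambda>e e'. F (tail ?G e)
    (\<lambda>i\<in>in_arcs ?G (tail ?G e). if i = e' then 1 else 0) e)"
  show "edge_equations N k z" if flow: "net_flow N F x z" for x z
    unfolding edge_equations_def
  proof (intro ballI)
    fix V e assume V: "V \<in> intermediates N" and e: "e \<in> out_arcs ?G V"
    have "z e = restrict z (out_arcs ?G V) e" using e by simp
    also have "\<dots> = F V (restrict z (in_arcs ?G V)) e"
      using flow V by (simp add: net_flow_def)
    also have "\<dots> = (\<Sum>e'\<in>in_arcs ?G V. F V (\<lambda>i\<in>in_arcs ?G V. if i = e' then 1 else 0) e
        * restrict z (in_arcs ?G V) e')"
      using assms V e
      by (intro linear_on_edges_coefficients) (auto simp: linear_network_code_def)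
    also have "\<dots> = (\<Sum>e'\<in>in_arcs ?G V. k e e' * z e')"
      using e by (intro sum.cong) (auto simp: k_def)
    finally show "z e = (\<Sum>e'\<in>in_arcs ?G V. k e e' * z e')" .
  qed
qed

definition flow_of :: "('v, 'e, 'c) code_family \<Rightarrow> ('e \<Rightarrow> 'c) \<Rightarrow> 'e \<Rightarrow> 'c" where
  "flow_of F x = (THE z. net_flow N F x z)"

lemma net_flow_flow_of:
  "network_code N F \<Longrightarrow> x \<in> out_arcs (graph N) (source N) \<rightarrow>\<^sub>E UNIV \<Longrightarrow> net_flow N F x (flow_of F x)"
  unfolding flow_of_def by (rule theI'[OF net_flow_unique])

lemma flow_of_source:
  assumes "network_code N F" "x \<in> out_arcs (graph N) (source N) \<rightarrow>\<^sub>E UNIV"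
    "e \<in> out_arcs (graph N) (source N)"
  shows "flow_of F x e = x e"
proof -
  have "restrict (flow_of F x) (out_arcs (graph N) (source N)) = x"
    using net_flow_flow_of[OF assms(1,2)] by (simp add: net_flow_def)
  then show ?thesis by (metis assms(3) restrict_apply')
qed

lemma transfer_eq_iff:
  "transfer N F T x = transfer N F T y \<longleftrightarrow>
     (\<forall>e\<in>in_arcs (graph N) T. flow_of F x e = flow_of F y e)"
  by (auto simp: transfer_def flow_of_def fun_eq_iff restrict_def)

text \<open>Achievability and converse in one rule: one pair attains \<open>r\<close> and no pair
  exceeds it. Finiteness of the set of rates makes \<open>Max\<close> meaningful.\<close>

lemma linear_capacity_eqI:
  assumes "outer_code N (C :: ('e \<Rightarrow> 'c :: {finite, field}) set)"
    "linear_network_code N F" "unambiguous N C F"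
    and "r = log (real CARD('c)) (real (card C))"
    and "\<And>(C :: ('e \<Rightarrow> 'c) set) F. outer_code N C \<Longrightarrow> linear_network_code N F \<Longrightarrow>
      unambiguous N C F \<Longrightarrow> log (real CARD('c)) (real (card C)) \<le> r"
  shows "linear_capacity TYPE('c) N = r"
  unfolding linear_capacity_def
proof (rule Max_eqI)
  show "finite (linear_rates TYPE('c) N)" by (rule finite_linear_rates)
  show "y \<le> r" if "y \<in> linear_rates TYPE('c) N" for y
    using that assms(5) by (auto simp: linear_rates_def)
  show "r \<in> linear_rates TYPE('c) N"
    using assms(1-4) unfolding linear_rates_def by blast
qed

end

section \<open>The network of the theorem\<close>

interpretation fig: network fig_network
  by (rule network_fig_network)

section \<open>Edge sets and flow equations of the concrete network\<close>

lemma fig_source_out: "out_arcs (graph fig_network) (source fig_network) = {(Src, V1), (Src, V2)}"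
  by (auto simp: fig_network_def fig_edges_def out_arcs_def)

lemma fig_intermediates: "intermediates fig_network = {V1, V2, V3, V4, V5, V6}"
  by (auto simp: intermediates_def fig_network_def UNIV_fig_vertex)

text \<open>Lets the simplifier filter the explicit edge list one edge at a time, so that in- and
  out-sets come out as literal sets.\<close>

lemma Collect_insert_conj:
  "{e. e \<in> insert a A \<and> P e} =
     (if P a then insert a {e. e \<in> A \<and> P e} else {e. e \<in> A \<and> P e})"
  by auto

lemma fig_out:
  "out_arcs (graph fig_network) V1 = {(V1, V3), (V1, V4), (V1, T1), (V1, T2)}"
  "out_arcs (graph fig_network) V2 = {(V2, V3), (V2, V4), (V2, T4), (V2, T5)}"
  "out_arcs (graph fig_network) V3 = {(V3, V5)}"
  "out_arcs (graph fig_network) V4 = {(V4, V6)}"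
  "out_arcs (graph fig_network) V5 = {(V5, T1), (V5, T3), (V5, T4)}"
  "out_arcs (graph fig_network) V6 = {(V6, T2), (V6, T3), (V6, T5)}"
  by (simp_all add: fig_network_def fig_edges_def out_arcs_def Collect_insert_conj del: insert_iff)

lemma fig_in:
  "in_arcs (graph fig_network) V1 = {(Src, V1)}"
  "in_arcs (graph fig_network) V2 = {(Src, V2)}"
  "in_arcs (graph fig_network) V3 = {(V1, V3), (V2, V3)}"
  "in_arcs (graph fig_network) V4 = {(V1, V4), (V2, V4)}"
  "in_arcs (graph fig_network) V5 = {(V3, V5)}"
  "in_arcs (graph fig_network) V6 = {(V4, V6)}"
  "in_arcs (graph fig_network) T1 = {(V1, T1), (V5, T1)}"
  "in_arcs (graph fig_network) T2 = {(V1, T2), (V6, T2)}"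
  "in_arcs (graph fig_network) T3 = {(V5, T3), (V6, T3)}"
  "in_arcs (graph fig_network) T4 = {(V2, T4), (V5, T4)}"
  "in_arcs (graph fig_network) T5 = {(V2, T5), (V6, T5)}"
  by (simp_all add: fig_network_def fig_edges_def in_arcs_def Collect_insert_conj del: insert_iff)

lemma fig_terminals: "terminals fig_network = {T1, T2, T3, T4, T5}"
  by (simp add: fig_network_def)

lemma fig_source_eqI:
  assumes "x \<in> {(Src, V1), (Src, V2)} \<rightarrow>\<^sub>E UNIV" "y \<in> {(Src, V1), (Src, V2)} \<rightarrow>\<^sub>E UNIV"
    "x (Src, V1) = y (Src, V1)" "x (Src, V2) = y (Src, V2)"
  shows "x = y"
  using assms by (auto intro: PiE_ext)

text \<open>Only \<open>V3\<close> and \<open>V4\<close> have two incoming edges and can mix; every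
  other intermediate vertex just scales its one input.\<close>

lemma fig_edge_equations:
  "edge_equations fig_network k z \<longleftrightarrow>
     (\<forall>v\<in>{V3, V4, T1, T2}. z (V1, v) = k (V1, v) (Src, V1) * z (Src, V1)) \<and>
     (\<forall>v\<in>{V3, V4, T4, T5}. z (V2, v) = k (V2, v) (Src, V2) * z (Src, V2)) \<and>
     z (V3, V5) = k (V3, V5) (V1, V3) * z (V1, V3) + k (V3, V5) (V2, V3) * z (V2, V3) \<and>
     z (V4, V6) = k (V4, V6) (V1, V4) * z (V1, V4) + k (V4, V6) (V2, V4) * z (V2, V4) \<and>
     (\<forall>v\<in>{T1, T3, T4}. z (V5, v) = k (V5, v) (V3, V5) * z (V3, V5)) \<and>
     (\<forall>v\<in>{T2, T3, T5}. z (V6, v) = k (V6, v) (V4, V6) * z (V4, V6))"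
  by (simp add: edge_equations_def fig_intermediates fig_out fig_in)

text \<open>Each terminal receives scalar multiples of two of the symbols x1, x2, p, r. Codewords
  that agree in these two are indistinguishable there, so injectivity of the transfer function
  passes to the pair of forms, even if some scalars are zero.\<close>

lemma fig_linear_forms:
  fixes C :: "(fig_vertex \<times> fig_vertex \<Rightarrow> 'a :: field) set"
  assumes C: "outer_code fig_network C" and lin: "linear_network_code fig_network F"
    and un: "unambiguous fig_network C F"
  obtains a b c d :: 'a where
    "\<forall>f \<in> {\<lambda>x. x (Src, V1), \<lambda>x. x (Src, V2)}.
       \<forall>g \<in> {\<lambda>x. a * x (Src, V1) + b * x (Src, V2), \<lambda>x. c * x (Src, V1) + d * x (Src, V2)}.
       inj_on (\<lambda>x. (f x, g x)) C"
    and "inj_on (\<lambda>x. (a * x (Src, V1) + b * x (Src, V2), c * x (Src, V1) + d * x (Src, V2))) C"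
proof -
  obtain k where k: "\<And>x z. net_flow fig_network F x z \<Longrightarrow> edge_equations fig_network k z"
    using fig.linear_flow_equations[OF lin] by blast
  have code: "network_code fig_network F" using lin by (simp add: linear_network_code_def)
  let ?z = "fig.flow_of F"
  \<comment> \<open>Each coefficient is the product of the local ones along the only path from a
    source edge to (V3, V5) or (V4, V6).\<close>
  define a where "a = k (V3, V5) (V1, V3) * k (V1, V3) (Src, V1)"
  define b where "b = k (V3, V5) (V2, V3) * k (V2, V3) (Src, V2)"
  define c where "c = k (V4, V6) (V1, V4) * k (V1, V4) (Src, V1)"
  define d where "d = k (V4, V6) (V2, V4) * k (V2, V4) (Src, V2)"
  have x: "x \<in> out_arcs (graph fig_network) (source fig_network) \<rightarrow>\<^sub>E UNIV" if "x \<in> C" for x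
    using C that by (auto simp: outer_code_def)
  have src: "?z x (Src, V1) = x (Src, V1)" "?z x (Src, V2) = x (Src, V2)" if "x \<in> C" for x
    using fig.flow_of_source[OF code x[OF that]] by (auto simp: fig_source_out)
  have eqs: "edge_equations fig_network k (?z x)" if "x \<in> C" for x
    using k fig.net_flow_flow_of[OF code x[OF that]] by blast
  have p: "?z x (V3, V5) = a * x (Src, V1) + b * x (Src, V2)" if "x \<in> C" for x
    using eqs[OF that] src[OF that] by (simp add: fig_edge_equations a_def b_def mult.assoc)
  have r: "?z x (V4, V6) = c * x (Src, V1) + d * x (Src, V2)" if "x \<in> C" for x
    using eqs[OF that] src[OF that] by (simp add: fig_edge_equations c_def d_def mult.assoc)
  have sep: "x = y" if "T \<in> {T1, T2, T3, T4, T5}" "x \<in> C" "y \<in> C"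
    "\<And>e. e \<in> in_arcs (graph fig_network) T \<Longrightarrow> ?z x e = ?z y e" for T x y
  proof -
    have "inj_on (transfer fig_network F T) C"
      using un that(1) unfolding unambiguous_def fig_terminals by blast
    moreover have "transfer fig_network F T x = transfer fig_network F T y"
      using that(4) by (simp add: fig.transfer_eq_iff)
    ultimately show ?thesis using that by (blast dest: inj_onD)
  qed
  note E = eqs[unfolded fig_edge_equations]
  define P where "P x = a * x (Src, V1) + b * x (Src, V2)" for x
  define R where "R x = c * x (Src, V1) + d * x (Src, V2)" for x
  \<comment> \<open>Every edge into a terminal depends on just one of x1, x2, \<open>P\<close>,
    \<open>R\<close>, since its scaling factor is the same for both codewords.\<close>
  have V1: "?z x (V1, v) = ?z y (V1, v)"
    if "x \<in> C" "y \<in> C" "x (Src, V1) = y (Src, V1)" "v \<in> {T1, T2}" for x y v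
    using E[OF that(1)] E[OF that(2)] src(1)[OF that(1)] src(1)[OF that(2)] that(3,4) by auto
  have V2: "?z x (V2, v) = ?z y (V2, v)"
    if "x \<in> C" "y \<in> C" "x (Src, V2) = y (Src, V2)" "v \<in> {T4, T5}" for x y v
    using E[OF that(1)] E[OF that(2)] src(2)[OF that(1)] src(2)[OF that(2)] that(3,4) by auto
  have V5: "?z x (V5, v) = ?z y (V5, v)"
    if "x \<in> C" "y \<in> C" "P x = P y" "v \<in> {T1, T3, T4}" for x y v
  proof -
    have "?z x (V3, V5) = ?z y (V3, V5)" using p that by (simp add: P_def)
    then show ?thesis using E[OF that(1)] E[OF that(2)] that(4) by metis
  qed
  have V6: "?z x (V6, v) = ?z y (V6, v)"
    if "x \<in> C" "y \<in> C" "R x = R y" "v \<in> {T2, T3, T5}" for x y v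
  proof -
    have "?z x (V4, V6) = ?z y (V4, V6)" using r that by (simp add: R_def)
    then show ?thesis using E[OF that(1)] E[OF that(2)] that(4) by metis
  qed
  \<comment> \<open>The five disjuncts correspond to \<open>T1\<close>, \<open>T2\<close>,
    \<open>T3\<close>, \<open>T4\<close>, \<open>T5\<close> in this order.\<close>
  have T: "x = y"
    if xy: "x \<in> C" "y \<in> C"
      and "x (Src, V1) = y (Src, V1) \<and> P x = P y \<or> x (Src, V1) = y (Src, V1) \<and> R x = R y \<or>
        P x = P y \<and> R x = R y \<or> x (Src, V2) = y (Src, V2) \<and> P x = P y \<or>
        x (Src, V2) = y (Src, V2) \<and> R x = R y" for x y
    using that(3)
  proof (elim disjE conjE)
    assume "x (Src, V1) = y (Src, V1)" "P x = P y"
    then show ?thesis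
      by (intro sep[of T1, OF _ xy]) (use V1[OF xy] V5[OF xy] in \<open>auto simp only: fig_in insert_iff\<close>)
  next
    assume "x (Src, V1) = y (Src, V1)" "R x = R y"
    then show ?thesis
      by (intro sep[of T2, OF _ xy]) (use V1[OF xy] V6[OF xy] in \<open>auto simp only: fig_in insert_iff\<close>)
  next
    assume "P x = P y" "R x = R y"
    then show ?thesis
      by (intro sep[of T3, OF _ xy]) (use V5[OF xy] V6[OF xy] in \<open>auto simp only: fig_in insert_iff\<close>)
  next
    assume "x (Src, V2) = y (Src, V2)" "P x = P y"
    then show ?thesis
      by (intro sep[of T4, OF _ xy]) (use V2[OF xy] V5[OF xy] in \<open>auto simp only: fig_in insert_iff\<close>)
  next
    assume "x (Src, V2) = y (Src, V2)" "R x = R y"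
    then show ?thesis
      by (intro sep[of T5, OF _ xy]) (use V2[OF xy] V6[OF xy] in \<open>auto simp only: fig_in insert_iff\<close>)
  qed
  show thesis
  proof
    show "inj_on (\<lambda>x. (a * x (Src, V1) + b * x (Src, V2), c * x (Src, V1) + d * x (Src, V2))) C"
      unfolding P_def[symmetric] R_def[symmetric] by (intro inj_onI T) auto
    show "\<forall>f \<in> {\<lambda>x. x (Src, V1), \<lambda>x. x (Src, V2)}.
       \<forall>g \<in> {\<lambda>x. a * x (Src, V1) + b * x (Src, V2), \<lambda>x. c * x (Src, V1) + d * x (Src, V2)}.
       inj_on (\<lambda>x. (f x, g x)) C"
      unfolding P_def[symmetric] R_def[symmetric]
    proof (intro ballI inj_onI T)
      fix f g :: "(fig_vertex \<times> fig_vertex \<Rightarrow> 'a) \<Rightarrow> 'a" and x y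
      assume "f \<in> {\<lambda>x. x (Src, V1), \<lambda>x. x (Src, V2)}" "g \<in> {P, R}" "(f x, g x) = (f y, g y)"
      then show "x (Src, V1) = y (Src, V1) \<and> P x = P y \<or> x (Src, V1) = y (Src, V1) \<and> R x = R y \<or>
        P x = P y \<and> R x = R y \<or> x (Src, V2) = y (Src, V2) \<and> P x = P y \<or>
        x (Src, V2) = y (Src, V2) \<and> R x = R y"
        by (elim insertE emptyE) simp_all
    qed
  qed
qed

section \<open>Explicit codes\<close>

text \<open>The code forwards symbols, except that \<open>V3\<close> sends \<open>x\<^sub>1 + b x\<^sub>2\<close> and \<open>V4\<close> sends \<open>x\<^sub>1 + d x\<^sub>2\<close>.\<close>

lemma fig_unambiguousI:
  fixes C :: "(fig_vertex \<times> fig_vertex \<Rightarrow> 'a :: field) set" and b d :: 'a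
  defines "k \<equiv> \<lambda>(e :: fig_vertex \<times> fig_vertex) e'.
    if e' = (V2, V3) then b else if e' = (V2, V4) then d else 1"
  assumes C: "outer_code fig_network C"
    and "\<And>x y. x \<in> C \<Longrightarrow> y \<in> C \<Longrightarrow>
      (\<exists>f \<in> {\<lambda>x. x (Src, V1), \<lambda>x. x (Src, V2)}. f x = f y \<and>
        (x (Src, V1) + b * x (Src, V2) = y (Src, V1) + b * y (Src, V2) \<or>
         x (Src, V1) + d * x (Src, V2) = y (Src, V1) + d * y (Src, V2))) \<or>
      (x (Src, V1) + b * x (Src, V2) = y (Src, V1) + b * y (Src, V2) \<and>
         x (Src, V1) + d * x (Src, V2) = y (Src, V1) + d * y (Src, V2)) \<Longrightarrow> x = y"
  shows "unambiguous fig_network C (coefficient_code fig_network k)"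
  unfolding unambiguous_def
proof (intro ballI inj_onI)
  let ?F = "coefficient_code fig_network k"
  let ?z = "fig.flow_of ?F"
  fix T x y
  assume T: "T \<in> terminals fig_network" and xy: "x \<in> C" "y \<in> C"
    and "transfer fig_network ?F T x = transfer fig_network ?F T y"
  then have eq: "\<forall>e\<in>in_arcs (graph fig_network) T. ?z x e = ?z y e"
    by (simp add: fig.transfer_eq_iff)
  have code: "network_code fig_network ?F"
    using linear_coefficient_code[of fig_network k] by (simp add: linear_network_code_def)
  have dom: "x \<in> out_arcs (graph fig_network) (source fig_network) \<rightarrow>\<^sub>E UNIV" if "x \<in> C" for x
    using C that by (auto simp: outer_code_def)
  have src: "?z x (Src, V1) = x (Src, V1)" "?z x (Src, V2) = x (Src, V2)" if "x \<in> C" for x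
    using fig.flow_of_source[OF code dom[OF that]] by (auto simp: fig_source_out)
  have eqs: "edge_equations fig_network k (?z x)" if "x \<in> C" for x
    using net_flow_coefficient_code fig.net_flow_flow_of[OF code dom[OF that]] by blast
  \<comment> \<open>Apart from \<open>b\<close> and \<open>d\<close> all factors are 1, so terminals
    receive the forms themselves, and each terminal matches one case of the hypothesis.\<close>
  have vals: "?z x (V1, T1) = x (Src, V1)" "?z x (V1, T2) = x (Src, V1)"
    "?z x (V2, T4) = x (Src, V2)" "?z x (V2, T5) = x (Src, V2)"
    "\<forall>v\<in>{T1, T3, T4}. ?z x (V5, v) = x (Src, V1) + b * x (Src, V2)"
    "\<forall>v\<in>{T2, T3, T5}. ?z x (V6, v) = x (Src, V1) + d * x (Src, V2)"
    if "x \<in> C" for x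
    using eqs[OF that] src[OF that] by (simp_all add: fig_edge_equations k_def)
  show "x = y"
    using T eq xy vals[OF xy(1)] vals[OF xy(2)]
    by (intro assms(3)) (auto simp: fig_terminals fig_in)
qed

section \<open>Upper bounds on the outer code\<close>

lemma fig_card_outer_code_le:
  assumes "outer_code fig_network (C :: (fig_vertex \<times> fig_vertex \<Rightarrow> 'a :: finite) set)"
  shows "card C \<le> CARD('a)\<^sup>2"
proof -
  let ?D = "{(Src, V1), (Src, V2)} \<rightarrow>\<^sub>E (UNIV :: 'a set)"
  have "finite ?D" by (intro finite_PiE) auto
  then have "card C \<le> card ?D"
    using assms by (intro card_mono) (auto simp: outer_code_def fig_source_out)
  also have "\<dots> = CARD('a)\<^sup>2" by (simp add: card_PiE power2_eq_square)
  finally show ?thesis .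
qed

lemma fig_binary_card_le:
  fixes C :: "(fig_vertex \<times> fig_vertex \<Rightarrow> 'a :: {finite, field}) set"
  assumes two: "CARD('a) = 2" and C: "outer_code fig_network C"
    and lin: "linear_network_code fig_network F" and un: "unambiguous fig_network C F"
  shows "card C \<le> 2"
proof (rule ccontr)
  assume "\<not> card C \<le> 2"
  \<comment> \<open>Pigeonhole: an injection into a two-element alphabet would force at most two
    codewords.\<close>
  then have noinj: "\<not> inj_on f C" for f :: "_ \<Rightarrow> 'a"
    using card_inj_on_le[of f C UNIV] two by auto
  have "(UNIV :: 'a set) = {0, 1}"
    using two by (intro card_subset_eq[symmetric]) auto
  then have bit: "u = 0 \<or> u = 1" for u :: 'a by blast
  obtain a b c d :: 'a where inj:
    "\<forall>f \<in> {\<lambda>x. x (Src, V1), \<lambda>x. x (Src, V2)}.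
       \<forall>g \<in> {\<lambda>x. a * x (Src, V1) + b * x (Src, V2), \<lambda>x. c * x (Src, V1) + d * x (Src, V2)}.
       inj_on (\<lambda>x. (f x, g x)) C"
    and inj3: "inj_on (\<lambda>x. (a * x (Src, V1) + b * x (Src, V2), c * x (Src, V1) + d * x (Src, V2))) C"
    by (rule fig_linear_forms[OF C lin un])
  \<comment> \<open>A zero coefficient makes the form a function of x1 alone or of x2 alone. The
    terminal that sees this same source symbol would then separate \<open>C\<close> by it, against
    \<open>noinj\<close>. In the binary field nonzero means 1.\<close>
  have one: "u = 1 \<and> v = 1"
    if u1: "inj_on (\<lambda>x. (x (Src, V1), u * x (Src, V1) + v * x (Src, V2))) C"
      and u2: "inj_on (\<lambda>x. (x (Src, V2), u * x (Src, V1) + v * x (Src, V2))) C" for u v :: 'a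
  proof -
    have "v \<noteq> 0"
    proof
      assume "v = 0"
      then have "inj_on (\<lambda>x. x (Src, V1)) C" using u1 by (auto simp: inj_on_def)
      then show False using noinj by blast
    qed
    moreover have "u \<noteq> 0"
    proof
      assume "u = 0"
      then have "inj_on (\<lambda>x. x (Src, V2)) C" using u2 by (auto simp: inj_on_def)
      then show False using noinj by blast
    qed
    ultimately show ?thesis using bit by blast
  qed
  have "a = 1 \<and> b = 1" "c = 1 \<and> d = 1"
    by (rule one; rule inj[rule_format]; simp)+
  \<comment> \<open>Both components of the pair seen by \<open>T3\<close> are now the same
    sum.\<close>
  then have "inj_on (\<lambda>x. x (Src, V1) + x (Src, V2)) C"
    using inj3 by (auto simp: inj_on_def)
  then show False using noinj by blast
qed

section \<open>The capacity for two and for more field elements\<close>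

theorem theorem6:
  fixes q :: nat
  assumes "primepow q"
    and "CARD('a :: {finite, field}) = q"
  shows "linear_capacity TYPE('a) fig_network = (if q = 2 then 1 else 2)"
proof (cases "q = 2")
  case True
  then have two: "CARD('a) = 2" using assms by simp
  \<comment> \<open>The repetition code: any one received symbol identifies the codeword, so
    \<open>V3\<close> and \<open>V4\<close> may simply forward x1, which is the choice of 0 for both
    parameters below.\<close>
  define rep :: "'a \<Rightarrow> fig_vertex \<times> fig_vertex \<Rightarrow> 'a"
    where "rep = (\<lambda>t. \<lambda>e\<in>{(Src, V1), (Src, V2)}. t)"
  let ?C = "range rep"
  have "inj rep" by (auto simp: inj_on_def rep_def fun_eq_iff)
  then have card: "card ?C = 2" by (simp add: card_image two)
  have C: "outer_code fig_network ?C"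
    by (simp add: outer_code_def fig_source_out rep_def image_subset_iff)
  have "linear_capacity TYPE('a) fig_network = 1"
  proof (rule fig.linear_capacity_eqI[OF C linear_coefficient_code fig_unambiguousI[OF C, of 0 0]])
    fix x y :: "fig_vertex \<times> fig_vertex \<Rightarrow> 'a"
    assume "x \<in> ?C" "y \<in> ?C" and
      eq: "(\<exists>f \<in> {\<lambda>x. x (Src, V1), \<lambda>x. x (Src, V2)}. f x = f y \<and>
        (x (Src, V1) + 0 * x (Src, V2) = y (Src, V1) + 0 * y (Src, V2) \<or>
         x (Src, V1) + 0 * x (Src, V2) = y (Src, V1) + 0 * y (Src, V2))) \<or>
      (x (Src, V1) + 0 * x (Src, V2) = y (Src, V1) + 0 * y (Src, V2) \<and>
         x (Src, V1) + 0 * x (Src, V2) = y (Src, V1) + 0 * y (Src, V2))"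
    then show "x = y" by (auto simp: rep_def)
  next
    fix C :: "(fig_vertex \<times> fig_vertex \<Rightarrow> 'a) set" and F
    assume "outer_code fig_network C" "linear_network_code fig_network F"
      "unambiguous fig_network C F"
    then have "card C \<le> 2" using two by (intro fig_binary_card_le)
    \<comment> \<open>Stated for every such \<open>n\<close>, so 0 is treated apart, through the
      value of \<open>log\<close> there.\<close>
    moreover have "log 2 (real n) \<le> 1" if "n \<le> 2" for n
      using that by (cases "n = 0") (auto simp: log_le_one_cancel_iff log_def)
    ultimately show "log (real CARD('a)) (real (card C)) \<le> 1" using two by simp
  qed (simp add: card two)
  then show ?thesis using True by simp
next
  case False
  then have q: "CARD('a) > 2" using primepow_gt_Suc_0[OF assms(1)] assms(2) by simp
  \<comment> \<open>A third scalar \<open>c\<close> supplies a form x1 + c x2 that is proportional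
    to none of x1, x2, x1 + x2.\<close>
  have "{0, 1} \<noteq> (UNIV :: 'a set)"
  proof
    assume "{0, 1} = (UNIV :: 'a set)"
    then have "CARD('a) = card {0, 1 :: 'a}" by simp
    then show False using q by simp
  qed
  then obtain c :: 'a where c: "c \<noteq> 0" "c \<noteq> 1" by blast
  let ?C = "{(Src, V1), (Src, V2)} \<rightarrow>\<^sub>E (UNIV :: 'a set)"
  have card: "card ?C = CARD('a)\<^sup>2" by (simp add: card_PiE power2_eq_square)
  have C: "outer_code fig_network ?C"
    unfolding outer_code_def fig_source_out by (simp add: PiE_eq_empty_iff)
  have "linear_capacity TYPE('a) fig_network = 2"
  proof (rule fig.linear_capacity_eqI[OF C linear_coefficient_code fig_unambiguousI[OF C, of 1 c]])
    fix x y :: "fig_vertex \<times> fig_vertex \<Rightarrow> 'a"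
    assume xy: "x \<in> ?C" "y \<in> ?C" and
      eq: "(\<exists>f \<in> {\<lambda>x. x (Src, V1), \<lambda>x. x (Src, V2)}. f x = f y \<and>
        (x (Src, V1) + 1 * x (Src, V2) = y (Src, V1) + 1 * y (Src, V2) \<or>
         x (Src, V1) + c * x (Src, V2) = y (Src, V1) + c * y (Src, V2))) \<or>
      (x (Src, V1) + 1 * x (Src, V2) = y (Src, V1) + 1 * y (Src, V2) \<and>
         x (Src, V1) + c * x (Src, V2) = y (Src, V1) + c * y (Src, V2))"
    \<comment> \<open>The pair at \<open>T3\<close> has determinant c - 1; subtracting the two
      equations isolates the second unknown.\<close>
    have solve: "u = u' \<and> v = v'" if "u + v = u' + v'" "u + c * v = u' + c * v'" for u u' v v' :: 'a
    proof -
      have "(c - 1) * (v - v') = (u + c * v) - (u' + c * v') - ((u + v) - (u' + v'))"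
        by (simp add: algebra_simps)
      then have "v = v'" using that c by simp
      then show ?thesis using that by simp
    qed
    \<comment> \<open>At the other terminals one source symbol is known, and the remaining one has
      coefficient 1 or \<open>c\<close> in the form, which cancels.\<close>
    have cases: "u = u' \<and> v = v'"
      if "(u = u' \<or> v = v') \<and> (u + v = u' + v' \<or> u + c * v = u' + c * v') \<or>
          u + v = u' + v' \<and> u + c * v = u' + c * v'" for u u' v v' :: 'a
      using that
    proof (elim disjE)
      assume "u + v = u' + v' \<and> u + c * v = u' + c * v'"
      then show ?thesis using solve by blast
    qed (use c in auto)
    have "x (Src, V1) = y (Src, V1) \<and> x (Src, V2) = y (Src, V2)"
      using eq by (intro cases) (simp only: bex_simps mult_1_left simp_thms)
    then show "x = y"
      by (intro fig_source_eqI[OF xy]) blast+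
  next
    fix C :: "(fig_vertex \<times> fig_vertex \<Rightarrow> 'a) set" and F
    assume C: "outer_code fig_network C"
    then have "C \<subseteq> ?C" by (simp add: outer_code_def fig_source_out)
    moreover have "finite ?C" by (intro finite_PiE) auto
    ultimately have "finite C" by (rule finite_subset)
    \<comment> \<open>Monotonicity of \<open>log\<close> needs a positive argument; this comes from
      nonemptiness and finiteness of \<open>C\<close>.\<close>
    then have "card C > 0" using C by (simp add: outer_code_def card_gt_0_iff)
    then have "log (real CARD('a)) (real (card C)) \<le> log (real CARD('a)) (real (CARD('a)\<^sup>2))"
      using q fig_card_outer_code_le[OF C] by (subst log_le_cancel_iff) auto
    also have "\<dots> = 2" using q by (simp add: log_nat_power)
    finally show "log (real CARD('a)) (real (card C)) \<le> 2" .
  qed (use q in \<open>simp add: card log_nat_power\<close>)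
  then show ?thesis using False by simp
qed

end
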